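(* Let $\mathcal H$ be a real Hilbert space and let $C_1,C_2,\dots,C_N\subseteq\mathcal H$ be closed affine subspaces with nonempty intersection $\bigcap_{i=1}^N C_i\neq\emptyset$. Set $C_{N+1}:=C_1$. Then, for any $x_0\in\mathcal H$, in norm, $$\lim_{n\to\infty}\left(\frac{1}{N}\sum_{i=1}^N T_{C_i,C_{i+1}}\right)^n x_0=P_{\operatorname{Fix} T_{[C_1\,C_2\,\dots\,C_N]}}x_0,$$ where $T_{[C_1\,C_2\,\dots\,C_N]}$ is the cyclic Douglas--Rachford operator.
   Context: For a nonempty closed convex set $C\subseteq\mathcal H$, $P_C:\mathcal H\to C$ denotes the nearest point projection onto $C$, and $R_C:=2P_C-I$ is the reflection about $C$, where $I$ is the identity operator. For nonempty closed convex $A,B\subseteq\mathcal H$, the $2$-set Douglas--Rachford operator is $T_{A,B}:=\frac{1}{2}(I+R_BR_A)$, where products of operators denote composition. The cyclic Douglas--Rachford operator is $$T_{[C_1\,C_2\,\dots\,C_N]}:=T_{C_N,C_1}\,T_{C_{N-1},C_N}\cdots T_{C_2,C_3}\,T_{C_1,C_2},$$ that is, $T_{C_1,C_2}$ is applied first and $T_{C_N,C_1}$ last. For $T:\mathcal H\to\mathcal H$, $\operatorname{Fix} T:=\{x\in\mathcal H: Tx=x\}$. *)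

theory Defs
  imports "HOL-Analysis.Analysis"
begin

(* The library's closest_point lives in class heine_borel, which forces finite dimension;
   here a real Hilbert space is a type of sort {real_inner,complete_space}.
   The description is proper whenever S is nonempty, closed and convex. *)
definition proj :: "'a::{real_inner,complete_space} set \<Rightarrow> 'a \<Rightarrow> 'a" where
  "proj S x = (THE p. p \<in> S \<and> (\<forall>y\<in>S. dist x p \<le> dist x y))"

definition refl_about :: "'a::{real_inner,complete_space} set \<Rightarrow> 'a \<Rightarrow> 'a" where
  "refl_about S x = 2 *\<^sub>R proj S x - x"

definition DR :: "'a::{real_inner,complete_space} set \<Rightarrow> 'a set \<Rightarrow> 'a \<Rightarrow> 'a" where
  "DR A B x = (1/2) *\<^sub>R (x + refl_about B (refl_about A x))"

(* The sets are C 1, ..., C N with N \<ge> 1; fold applies the operator of index 1 first. *)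
definition cyclic_DR :: "(nat \<Rightarrow> 'a::{real_inner,complete_space} set) \<Rightarrow> nat \<Rightarrow> 'a \<Rightarrow> 'a" where
  "cyclic_DR C N x = DR (C N) (C 1) (fold (\<lambda>i. DR (C i) (C (Suc i))) [1..<N] x)"

definition Fix :: "('a \<Rightarrow> 'a) \<Rightarrow> 'a set" where
  "Fix T = {x. T x = x}"

end

theory Submission
  imports Defs
begin

text \<open>
  After translating a common point of the sets to the origin, each Douglas--Rachford operator
  \<open>T\<close> is linear of the form \<open>(I + U) / 2\<close> with \<open>U\<close> a linear isometry, and the average \<open>A\<close>
  of these operators is \<open>(I + U) / 2\<close> with \<open>U\<close> linear and nonexpansive. Such an \<open>A\<close> satisfies
  \<open>\<parallel>A x\<parallel>\<^sup>2 \<le> \<langle>A x, x\<rangle>\<close>, which makes \<open>A\<close> asymptotically regular and makes the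
  orthogonal complement of the range of \<open>I - A\<close> equal to the fixed space of \<open>A\<close>; hence
  \<open>A\<^sup>n\<close> tends to 0 on the closure of that range and the iterates converge to the projection
  onto the fixed space. The same inequality shows that a fixed point of the average, or of the
  composition, is fixed by every factor, so both have the same fixed points.
\<close>

section \<open>Projections onto closed affine sets\<close>

text \<open>Orthogonality yields Pythagoras' identity, so every other point of \<open>S\<close> is
  strictly farther from \<open>x\<close> and the description in \<open>proj\<close> selects
  \<open>p\<close>.\<close>

lemma proj_eqI:
  assumes "p \<in> S" and "\<And>y. y \<in> S \<Longrightarrow> (x - p) \<bullet> (y - p) = 0"
  shows "proj S x = p"
proof -
  have pyth: "(dist x y)\<^sup>2 = (dist x p)\<^sup>2 + (dist p y)\<^sup>2" if "y \<in> S" for y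
    using assms(2)[OF that]
    by (simp add: dist_norm power2_norm_eq_inner inner_diff inner_commute algebra_simps)
  show ?thesis
    unfolding proj_def
  proof (rule the_equality)
    have "dist x p \<le> dist x y" if "y \<in> S" for y
      using pyth[OF that] by (auto intro: power2_le_imp_le[of _ "dist x y"])
    then show "p \<in> S \<and> (\<forall>y\<in>S. dist x p \<le> dist x y)"
      using assms(1) by blast
  next
    fix q assume q: "q \<in> S \<and> (\<forall>y\<in>S. dist x q \<le> dist x y)"
    then have "(dist x q)\<^sup>2 \<le> (dist x p)\<^sup>2"
      using assms(1) by (intro power_mono) auto
    with pyth q have "(dist p q)\<^sup>2 \<le> 0"
      by (metis add_le_same_cancel1)
    then show "q = p" by simp
  qed
qed

text \<open>The parallelogram law makes a minimizing sequence Cauchy: midpoints stay in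
  \<open>S\<close>, hence at distance at least \<open>d\<close> from \<open>x\<close>. Completeness
  and closedness then supply the limit.\<close>

lemma nearest_point_exists:
  fixes S :: "'a::{real_inner,complete_space} set"
  assumes "closed S" "convex S" "S \<noteq> {}"
  shows "\<exists>p\<in>S. \<forall>y\<in>S. dist x p \<le> dist x y"
proof -
  define d where "d = infdist x S"
  have d0: "0 \<le> d" by (simp add: d_def infdist_nonneg)
  have dle: "d \<le> dist x y" if "y \<in> S" for y
    using that by (simp add: d_def infdist_le)
  have "\<exists>y\<in>S. (dist x y)\<^sup>2 < d\<^sup>2 + inverse (Suc n)" for n
  proof -
    define r where "r = sqrt (d\<^sup>2 + inverse (Suc n))"
    have "d < r"
      unfolding r_def by (rule real_less_rsqrt) simp
    then have "\<exists>y\<in>S. dist x y < r"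
      using \<open>S \<noteq> {}\<close> cInf_lessD[of "dist x ` S" r]
      by (auto simp: d_def infdist_def)
    then obtain y where y: "y \<in> S" "dist x y < r" by blast
    then have "(dist x y)\<^sup>2 < r\<^sup>2"
      by (intro power_strict_mono) auto
    then show ?thesis
      using y(1) by (auto simp: r_def)
  qed
  then obtain y where yS: "\<And>n. y n \<in> S"
    and yd: "\<And>n. (dist x (y n))\<^sup>2 < d\<^sup>2 + inverse (Suc n)" by metis
  have gap: "(dist (y m) (y n))\<^sup>2 \<le> 2 * inverse (Suc m) + 2 * inverse (Suc n)" for m n
  proof -
    have "midpoint (y m) (y n) \<in> S"
      using convexD[OF assms(2) yS yS, of "1/2" "1/2" m n]
      by (simp add: midpoint_def scaleR_right_distrib)
    then have "d\<^sup>2 \<le> (dist x (midpoint (y m) (y n)))\<^sup>2"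
      using dle d0 by (intro power_mono) auto
    moreover have "(dist (y m) (y n))\<^sup>2 =
        2 * (dist x (y m))\<^sup>2 + 2 * (dist x (y n))\<^sup>2 - 4 * (dist x (midpoint (y m) (y n)))\<^sup>2"
      by (simp add: dist_norm power2_norm_eq_inner inner_diff inner_add midpoint_def
          inner_commute algebra_simps)
    ultimately show ?thesis
      using yd[of m] yd[of n] by linarith
  qed
  have "Cauchy y"
  proof (rule metric_CauchyI)
    fix e :: real assume e: "0 < e"
    then obtain M where M: "inverse (Suc M) < e\<^sup>2 / 4"
      using reals_Archimedean[of "e\<^sup>2 / 4"] by auto
    have "dist (y m) (y n) < e" if "m \<ge> M" "n \<ge> M" for m n
    proof -
      have "inverse (real (Suc m)) \<le> inverse (Suc M)" "inverse (real (Suc n)) \<le> inverse (Suc M)"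
        using that by (auto intro!: le_imp_inverse_le)
      then have "(dist (y m) (y n))\<^sup>2 < e\<^sup>2"
        using gap[of m n] M by linarith
      then show ?thesis
        using e by (auto intro: power2_less_imp_less[of _ e])
    qed
    then show "\<exists>M. \<forall>m\<ge>M. \<forall>n\<ge>M. dist (y m) (y n) < e" by blast
  qed
  then obtain p where p: "y \<longlonglongrightarrow> p"
    using Cauchy_convergent convergent_def by blast
  have "p \<in> S"
    using closed_sequentially[OF assms(1) _ p] yS by blast
  have "(\<lambda>n. (dist x (y n))\<^sup>2) \<longlonglongrightarrow> (dist x p)\<^sup>2"
    by (intro tendsto_intros p)
  moreover have "(\<lambda>n. d\<^sup>2 + inverse (real (Suc n))) \<longlonglongrightarrow> d\<^sup>2 + 0"
    by (intro tendsto_intros LIMSEQ_inverse_real_of_nat)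
  ultimately have "(dist x p)\<^sup>2 \<le> d\<^sup>2 + 0"
    by (rule LIMSEQ_le) (use yd less_imp_le in blast)
  then have "dist x p \<le> d"
    using d0 by (simp add: power2_le_iff_abs_le)
  with dle \<open>p \<in> S\<close> show ?thesis
    by (meson order_trans)
qed

text \<open>An affine set contains the whole line through \<open>p\<close> and \<open>y\<close>, so
  minimality can be tested in both directions and gives orthogonality rather than only an
  inequality.\<close>

lemma affine_proj:
  fixes S :: "'a::{real_inner,complete_space} set"
  assumes "closed S" "affine S" "S \<noteq> {}"
  shows "proj S x \<in> S" and "y \<in> S \<Longrightarrow> (x - proj S x) \<bullet> (y - proj S x) = 0"
proof -
  obtain p where p: "p \<in> S" "\<forall>y\<in>S. dist x p \<le> dist x y"
    using nearest_point_exists[OF assms(1) affine_imp_convex[OF assms(2)] assms(3)] by blast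
  have orth: "(x - p) \<bullet> (y - p) = 0" if "y \<in> S" for y
  proof (cases "y = p")
    case False
    \<comment> \<open>This \<open>t\<close> minimizes \<open>norm (u - t *\<^sub>R v)\<close>; the
      decrease it achieves is exactly
      \<open>(u \<bullet> v)\<^sup>2 / (v \<bullet> v)\<close>.\<close>
    define u v t where "u = x - p" and "v = y - p" and "t = (u \<bullet> v) / (v \<bullet> v)"
    have "v \<bullet> v > 0" using False by (simp add: v_def)
    have "(1 - t) *\<^sub>R p + t *\<^sub>R y \<in> S"
      using assms(2) p(1) that by (auto simp: affine_def)
    moreover have "x - ((1 - t) *\<^sub>R p + t *\<^sub>R y) = u - t *\<^sub>R v"
      by (simp add: u_def v_def algebra_simps)
    ultimately have "norm u \<le> norm (u - t *\<^sub>R v)"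
      using p(2) by (metis dist_norm u_def)
    then have "u \<bullet> u \<le> (u - t *\<^sub>R v) \<bullet> (u - t *\<^sub>R v)"
      by (simp add: norm_le)
    also have "\<dots> = u \<bullet> u - (u \<bullet> v)\<^sup>2 / (v \<bullet> v)"
      using \<open>v \<bullet> v > 0\<close>
      by (simp add: inner_diff inner_commute t_def power2_eq_square)
    finally have "(u \<bullet> v)\<^sup>2 / (v \<bullet> v) \<le> 0" by simp
    then have "(u \<bullet> v)\<^sup>2 \<le> 0"
      using \<open>v \<bullet> v > 0\<close> by (simp add: divide_le_0_iff)
    then show ?thesis by (simp add: u_def v_def)
  qed simp
  have "proj S x = p"
    by (rule proj_eqI) (use p orth in auto)
  then show "proj S x \<in> S" "y \<in> S \<Longrightarrow> (x - proj S x) \<bullet> (y - proj S x) = 0"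
    using p orth by auto
qed

section \<open>Linear firmly nonexpansive operators\<close>

text \<open>Firm nonexpansiveness of a linear map, encoded through its reflection
  \<open>2L - I\<close>: this form passes directly to averages and is immediate for
  Douglas--Rachford operators.\<close>

definition firm :: "('a::real_inner \<Rightarrow> 'a) \<Rightarrow> bool" where
  "firm L \<longleftrightarrow> linear L \<and> (\<forall>x. norm (2 *\<^sub>R L x - x) \<le> norm x)"

lemma firm_inner:
  assumes "firm L" shows "L x \<bullet> L x \<le> L x \<bullet> x"
proof -
  have "norm (2 *\<^sub>R L x - x) \<le> norm x"
    using assms by (simp add: firm_def)
  then have "(2 *\<^sub>R L x - x) \<bullet> (2 *\<^sub>R L x - x) \<le> x \<bullet> x"
    by (simp add: norm_le)
  then show ?thesis
    by (simp add: inner_diff inner_commute)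
qed

lemma firm_displacement:
  assumes "firm L" shows "(norm (x - L x))\<^sup>2 \<le> (norm x)\<^sup>2 - (norm (L x))\<^sup>2"
  using firm_inner[OF assms, of x]
  by (simp add: power2_norm_eq_inner inner_diff inner_commute)

lemma firm_norm_le:
  assumes "firm L" shows "norm (L x) \<le> norm x"
proof -
  have "(norm (L x))\<^sup>2 \<le> (norm x)\<^sup>2"
    using firm_displacement[OF assms, of x] by (smt (verit) zero_le_power2)
  then show ?thesis by (rule power2_le_imp_le) simp
qed

text \<open>A strict loss of norm accompanies every nonzero displacement. This is the rigidity used
  for compositions; \<open>firm_inner_eq\<close> is its counterpart for averages.\<close>

lemma firm_norm_eq:
  assumes "firm L" "norm x \<le> norm (L x)" shows "L x = x"
proof -
  have "(norm x)\<^sup>2 \<le> (norm (L x))\<^sup>2"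
    using assms(2) by (intro power_mono) auto
  with firm_displacement[OF assms(1), of x] have "(norm (x - L x))\<^sup>2 \<le> 0"
    by linarith
  then show ?thesis by simp
qed

lemma firm_inner_le:
  assumes "firm L" shows "L x \<bullet> x \<le> x \<bullet> x"
  using norm_cauchy_schwarz[of "L x" x] firm_norm_le[OF assms, of x]
  by (metis inner_commute mult_right_mono norm_ge_zero order_trans power2_eq_square
      power2_norm_eq_inner)

lemma firm_inner_eq:
  assumes "firm L" "x \<bullet> x \<le> L x \<bullet> x" shows "L x = x"
proof -
  have "(x - L x) \<bullet> (x - L x) \<le> 0"
    using firm_inner[OF assms(1), of x] assms(2)
    by (simp add: inner_diff inner_commute)
  then show ?thesis
    by (metis eq_iff_diff_eq_0 inner_ge_zero inner_eq_zero_iff order_antisym)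
qed

text \<open>Perturbing the fixed vector to \<open>f + t *\<^sub>R y\<close> in
  \<open>firm_inner\<close> gives \<open>0 \<le> t * a + t * t * b\<close> for all real
  \<open>t\<close>; the linear term dominates near 0 and changes sign, so \<open>a\<close> must
  vanish.\<close>

lemma firm_fixed_orthogonal:
  assumes "firm L" "L f = f" shows "f \<bullet> (y - L y) = 0"
proof (rule ccontr)
  define a b where "a = f \<bullet> (y - L y)" and "b = L y \<bullet> (y - L y)"
  assume "f \<bullet> (y - L y) \<noteq> 0"
  then have "a \<noteq> 0" by (simp add: a_def)
  have lin: "linear L" using assms(1) by (simp add: firm_def)
  have nonneg: "0 \<le> t * a + t * t * b" for t
  proof -
    have "L (f + t *\<^sub>R y) = f + t *\<^sub>R L y"
      using assms(2) by (simp add: linear_add[OF lin] linear_scale[OF lin])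
    from firm_inner[OF assms(1), of "f + t *\<^sub>R y", unfolded this]
    have "0 \<le> (f + t *\<^sub>R L y) \<bullet> ((f + t *\<^sub>R y) - (f + t *\<^sub>R L y))"
      by (simp only: inner_diff_right diff_ge_0_iff_ge)
    also have "\<dots> = (f + t *\<^sub>R L y) \<bullet> (t *\<^sub>R (y - L y))"
      by (simp add: algebra_simps)
    also have "\<dots> = t * a + t * t * b"
      by (simp add: a_def b_def inner_add_left algebra_simps)
    finally show ?thesis .
  qed
  \<comment> \<open>Any positive \<open>k\<close> above \<open>b\<close> works: at
    \<open>t = - a / k\<close> the quadratic equals \<open>a * a * (b - k) / (k * k)\<close>, which
    is negative.\<close>
  define k where "k = 1 + \<bar>b\<bar>"
  have k: "k > 0" "b < k" by (auto simp: k_def)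
  define t where "t = - a / k"
  have "t * a + t * t * b = (a * a) * (b - k) / (k * k)"
    using k(1) by (simp add: t_def field_simps)
  also have "\<dots> < 0"
    using k \<open>a \<noteq> 0\<close> by (intro divide_neg_pos mult_pos_neg) (auto simp: mult_less_0_iff zero_less_mult_iff)
  finally have "t * a + t * t * b < 0" .
  with nonneg[of t] show False by simp
qed

section \<open>Convergence of the iterates\<close>

lemma firm_funpow:
  assumes "firm L"
  shows "linear (L ^^ n)" and "norm ((L ^^ n) x) \<le> norm x"
proof -
  show "linear (L ^^ n)"
    using assms
    by (induction n) (auto simp: firm_def id_def[symmetric] intro: linear_id linear_compose)
  show "norm ((L ^^ n) x) \<le> norm x"
    by (induction n) (auto intro: order_trans[OF firm_norm_le[OF assms]])
qed

text \<open>The squared displacements are bounded by consecutive differences of the decreasing,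
  nonnegative sequence \<open>s\<close>, and these differences tend to 0.\<close>

lemma firm_asymptotically_regular:
  assumes "firm L"
  shows "(\<lambda>n. (L ^^ n) (y - L y)) \<longlonglongrightarrow> 0"
proof -
  define s where "s n = (norm ((L ^^ n) y))\<^sup>2" for n
  have bound: "(norm ((L ^^ n) (y - L y)))\<^sup>2 \<le> s n - s (Suc n)" for n
    using firm_displacement[OF assms, of "(L ^^ n) y"]
    by (simp add: s_def linear_diff[OF firm_funpow(1)[OF assms]] funpow_swap1)
  have "decseq s"
    by (rule decseq_SucI) (use bound in \<open>smt (verit) zero_le_power2\<close>)
  then obtain l where l: "s \<longlonglongrightarrow> l"
    using decseq_convergent[of s 0] by (auto simp: s_def)
  then have "(\<lambda>n. s n - s (Suc n)) \<longlonglongrightarrow> l - l"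
    by (intro tendsto_diff LIMSEQ_Suc)
  then have lim: "(\<lambda>n. s n - s (Suc n)) \<longlonglongrightarrow> 0" by simp
  have "(\<lambda>n. (norm ((L ^^ n) (y - L y)))\<^sup>2) \<longlonglongrightarrow> 0"
    by (rule tendsto_sandwich[OF _ _ tendsto_const lim]) (auto intro: bound always_eventually)
  from tendsto_real_sqrt[OF this] show ?thesis
    by (simp add: tendsto_norm_zero_iff)
qed

lemma subspace_closure:
  fixes S :: "'a::real_normed_vector set"
  assumes "subspace S" shows "subspace (closure S)"
  unfolding subspace_def
proof (intro conjI ballI allI)
  show "0 \<in> closure S"
    using subspace_0[OF assms] closure_subset by blast
next
  fix x y assume "x \<in> closure S" "y \<in> closure S"
  then obtain f g where "\<forall>n. f n \<in> S" "f \<longlonglongrightarrow> x" "\<forall>n. g n \<in> S" "g \<longlonglongrightarrow> y"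
    by (auto simp: closure_sequential)
  then show "x + y \<in> closure S"
    unfolding closure_sequential
    by (intro exI[of _ "\<lambda>n. f n + g n"]) (auto intro: tendsto_add subspace_add[OF assms])
next
  fix a x assume "x \<in> closure S"
  then obtain f where "\<forall>n. f n \<in> S" "f \<longlonglongrightarrow> x"
    by (auto simp: closure_sequential)
  then show "a *\<^sub>R x \<in> closure S"
    unfolding closure_sequential
    by (intro exI[of _ "\<lambda>n. a *\<^sub>R f n"])
      (auto intro: tendsto_scaleR tendsto_const subspace_scale[OF assms])
qed

text \<open>Splitting \<open>x = (x - w) + w\<close> with \<open>w\<close> the projection onto the
  closed range of displacements leaves a fixed part and a part that the iterates send to 0.\<close>

lemma firm_iterates_converge:
  fixes L :: "'a::{real_inner,complete_space} \<Rightarrow> 'a"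
  assumes "firm L"
  obtains p where "(\<lambda>n. (L ^^ n) x) \<longlonglongrightarrow> p" and "L p = p"
    and "\<And>f. L f = f \<Longrightarrow> (x - p) \<bullet> f = 0"
proof -
  define W where "W = closure (range (\<lambda>y. y - L y))"
  have lin: "linear L" using assms by (simp add: firm_def)
  have "linear (\<lambda>y. y - L y)"
    by (intro linear_compose_sub lin linear_ident)
  then have sub: "subspace W"
    unfolding W_def by (intro subspace_closure linear_subspace_image subspace_UNIV)
  then have W: "closed W" "affine W" "W \<noteq> {}"
    using subspace_imp_affine subspace_0 by (auto simp: W_def)
  define w where "w = proj W x"
  have orth: "(x - w) \<bullet> (z - w) = 0" if "z \<in> W" for z
    using affine_proj(2)[OF W that] by (simp add: w_def)
  have wW: "w \<in> W" by (simp add: w_def affine_proj(1)[OF W])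
  \<comment> \<open>Testing with \<open>w + z\<close>, which lies in the subspace \<open>W\<close>,
    turns orthogonality to differences into orthogonality to \<open>z\<close> itself.\<close>
  have perp: "(x - w) \<bullet> z = 0" if "z \<in> W" for z
    using orth[OF subspace_add[OF sub wW that]] by simp
  show ?thesis
  proof
    \<comment> \<open>The vector \<open>x - w\<close> is orthogonal to its own displacement, which
      is the equality case of \<open>firm_inner_eq\<close>.\<close>
    have "(x - w) - L (x - w) \<in> W"
      unfolding W_def by (rule subsetD[OF closure_subset]) (rule rangeI)
    from perp[OF this] have "(x - w) \<bullet> (x - w) = L (x - w) \<bullet> (x - w)"
      by (metis inner_commute inner_diff_right right_minus_eq)
    then show fixed: "L (x - w) = x - w"
      by (intro firm_inner_eq[OF assms]) simp
    \<comment> \<open>Replacing \<open>w\<close> by a nearby displacement \<open>y - L y\<close>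
      costs less than \<open>e / 2\<close> uniformly in \<open>n\<close>, since powers of
      \<open>L\<close> do not increase norms.\<close>
    have "(\<lambda>n. (L ^^ n) w) \<longlonglongrightarrow> 0"
    proof (rule LIMSEQ_I)
      fix e :: real assume "0 < e"
      then have "0 < e / 2" by simp
      with wW obtain y where y: "norm ((y - L y) - w) < e / 2"
        unfolding W_def closure_approachable dist_norm by blast
      obtain M where M: "\<And>n. n \<ge> M \<Longrightarrow> norm ((L ^^ n) (y - L y)) < e / 2"
        using LIMSEQ_D[OF firm_asymptotically_regular[OF assms, of y], of "e / 2"] \<open>0 < e\<close>
        by auto
      have "norm ((L ^^ n) w) < e" if "n \<ge> M" for n
      proof -
        have "(L ^^ n) w = (L ^^ n) (y - L y) - (L ^^ n) ((y - L y) - w)"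
          by (simp add: linear_diff[OF firm_funpow(1)[OF assms]])
        then have "norm ((L ^^ n) w) \<le> norm ((L ^^ n) (y - L y)) + norm ((y - L y) - w)"
          by (metis add_left_mono firm_funpow(2)[OF assms] norm_triangle_ineq4 order_trans)
        with M[OF that] y show ?thesis by linarith
      qed
      then show "\<exists>M. \<forall>n\<ge>M. norm ((L ^^ n) w - 0) < e" by auto
    qed
    moreover have "(L ^^ n) x = (x - w) + (L ^^ n) w" for n
    proof -
      have "(L ^^ n) (x - w) = x - w"
        using fixed by (induction n) auto
      then show ?thesis
        by (simp add: linear_diff[OF firm_funpow(1)[OF assms]] algebra_simps)
    qed
    ultimately show "(\<lambda>n. (L ^^ n) x) \<longlonglongrightarrow> x - w"
      using tendsto_add[OF tendsto_const[of "x - w"], of "\<lambda>n. (L ^^ n) w" 0] by simp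
    fix f assume f: "L f = f"
    have "W \<subseteq> {z. f \<bullet> z = 0}"
      unfolding W_def
      by (rule closure_minimal) (auto simp: firm_fixed_orthogonal[OF assms f] closed_hyperplane)
    with wW show "(x - (x - w)) \<bullet> f = 0"
      by (auto simp: inner_commute)
  qed
qed

section \<open>Fixed points of averages and compositions\<close>

text \<open>The reflection of the average is the average of the reflections, so the triangle
  inequality suffices.\<close>

lemma firm_average:
  assumes "finite I" "I \<noteq> {}" "\<And>i. i \<in> I \<Longrightarrow> firm (L i)"
  shows "firm (\<lambda>x. (1 / real (card I)) *\<^sub>R (\<Sum>i\<in>I. L i x))"
proof -
  have k: "real (card I) > 0"
    using assms by (simp add: card_gt_0_iff)
  have "linear (\<lambda>x. (1 / real (card I)) *\<^sub>R (\<Sum>i\<in>I. L i x))"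
    using assms(3) by (intro linear_compose_scale_right linear_compose_sum) (auto simp: firm_def)
  moreover have "norm (2 *\<^sub>R (1 / real (card I)) *\<^sub>R (\<Sum>i\<in>I. L i x) - x) \<le> norm x" for x
  proof -
    have "2 *\<^sub>R (1 / real (card I)) *\<^sub>R (\<Sum>i\<in>I. L i x) - x
        = (1 / real (card I)) *\<^sub>R (\<Sum>i\<in>I. 2 *\<^sub>R L i x - x)"
      using k by (simp add: sum_subtractf scaleR_diff_right sum_constant_scaleR
          flip: scaleR_sum_right)
    also have "norm \<dots> = (1 / real (card I)) * norm (\<Sum>i\<in>I. 2 *\<^sub>R L i x - x)"
      by simp
    also have "\<dots> \<le> (1 / real (card I)) * (\<Sum>i\<in>I. norm x)"
      using assms(3) by (intro mult_left_mono sum_norm_le) (auto simp: firm_def)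
    also have "\<dots> = norm x" using k by simp
    finally show ?thesis .
  qed
  ultimately show ?thesis unfolding firm_def by blast
qed

text \<open>Pairing the fixed-point equation with \<open>x\<close> makes the nonnegative numbers
  \<open>x \<bullet> x - L i x \<bullet> x\<close> sum to 0, so each one vanishes.\<close>

lemma firm_average_fixed_iff:
  assumes "finite I" "I \<noteq> {}" "\<And>i. i \<in> I \<Longrightarrow> firm (L i)"
  shows "(1 / real (card I)) *\<^sub>R (\<Sum>i\<in>I. L i x) = x \<longleftrightarrow> (\<forall>i\<in>I. L i x = x)"
proof
  have k: "real (card I) > 0"
    using assms by (simp add: card_gt_0_iff)
  show "(1 / real (card I)) *\<^sub>R (\<Sum>i\<in>I. L i x) = x" if "\<forall>i\<in>I. L i x = x"
    using that k by (simp add: sum_constant_scaleR)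
  assume "(1 / real (card I)) *\<^sub>R (\<Sum>i\<in>I. L i x) = x"
  then have "(\<Sum>i\<in>I. L i x) = real (card I) *\<^sub>R x"
    using k by (metis divide_self_if less_irrefl mult.commute scaleR_one scaleR_scaleR
        times_divide_eq_right mult_1_right)
  then have "(\<Sum>i\<in>I. L i x) \<bullet> x = real (card I) * (x \<bullet> x)" by simp
  then have "(\<Sum>i\<in>I. x \<bullet> x - L i x \<bullet> x) = 0"
    by (simp add: sum_subtractf inner_sum_left)
  then have "\<forall>i\<in>I. x \<bullet> x - L i x \<bullet> x = 0"
    using assms(1,3) firm_inner_le by (subst (asm) sum_nonneg_eq_0_iff) auto
  then show "\<forall>i\<in>I. L i x = x"
    using assms(3) by (auto intro!: firm_inner_eq)
qed

text \<open>No factor increases the distance to \<open>c\<close>, so a point fixed by the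
  composition keeps that distance at every stage, and each factor fixes it in turn.\<close>

lemma fold_fixed_iff:
  assumes "\<And>i. i \<in> set is \<Longrightarrow> firm (L i)"
    and "\<And>i x. i \<in> set is \<Longrightarrow> T i x = c + L i (x - c)"
  shows "fold T is x = x \<longleftrightarrow> (\<forall>i\<in>set is. T i x = x)"
proof -
  \<comment> \<open>The induction assumes only that the distance to \<open>c\<close> does not drop:
    being fixed by the whole fold would not pass to the tail of the list.\<close>
  have "norm (fold T is x - c) \<le> norm (x - c) \<and>
      (norm (x - c) \<le> norm (fold T is x - c) \<longrightarrow> (\<forall>i\<in>set is. T i x = x))"
    using assms
  proof (induction "is" arbitrary: x)
    case (Cons i "is")
    have i: "firm (L i)" "T i x - c = L i (x - c)"
      using Cons.prems by auto
    have le: "norm (T i x - c) \<le> norm (x - c)"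
      using firm_norm_le[OF i(1)] i(2) by simp
    have IH: "norm (fold T is (T i x) - c) \<le> norm (T i x - c)"
      "norm (T i x - c) \<le> norm (fold T is (T i x) - c) \<Longrightarrow> \<forall>j\<in>set is. T j (T i x) = T i x"
      using Cons.IH[of "T i x"] Cons.prems by auto
    have "T i x = x" if "norm (x - c) \<le> norm (T i x - c)"
      using firm_norm_eq[OF i(1), of "x - c"] that i(2) by simp
    with le IH show ?case by (auto intro: order_trans)
  qed simp
  moreover have "fold T is x = x" if "\<forall>i\<in>set is. T i x = x"
    using that by (induction "is") auto
  ultimately show ?thesis by auto
qed

section \<open>Douglas--Rachford operators after translation\<close>

text \<open>Here \<open>Q\<close> is the orthogonal projection onto the linear space
  \<open>S - c\<close>, and \<open>R\<close> is its reflection \<open>2Q - I\<close>.\<close>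

lemma refl_about_linear_part:
  assumes "closed S" "affine S" "c \<in> S"
  obtains R where "linear R" "\<And>y. norm (R y) = norm y" "\<And>x. refl_about S x = c + R (x - c)"
proof
  have ne: "S \<noteq> {}" using assms by blast
  note P = affine_proj[OF assms(1,2) ne]
  define Q where "Q y = proj S (c + y) - c" for y
  \<comment> \<open>The relations for \<open>z\<close> and for \<open>c\<close> are subtracted,
    which removes the projected point from the second factor.\<close>
  have orth: "(y - Q y) \<bullet> (z - c) = 0" if "z \<in> S" for y z
    using P(2)[OF that, of "c + y"] P(2)[OF assms(3), of "c + y"]
    by (simp add: Q_def inner_diff algebra_simps)
  have QI: "Q y = q" if "c + q \<in> S" "\<And>z. z \<in> S \<Longrightarrow> (y - q) \<bullet> (z - c) = 0" for y q
  proof -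
    have "proj S (c + y) = c + q"
      using that(1) that(2)[OF that(1)] that(2)
      by (intro proj_eqI) (auto simp: inner_diff_right inner_add_right)
    then show ?thesis by (simp add: Q_def)
  qed
  have QS: "c + Q y \<in> S" for y
    using P(1) by (simp add: Q_def)
  have comb: "c + (a *\<^sub>R u + b *\<^sub>R v) \<in> S" if "c + u \<in> S" "c + v \<in> S" for a b u v
  proof -
    have "subspace ((+) (- c) ` S)"
      using affine_diffs_subspace[OF assms(2,3)] by simp
    moreover have "u \<in> (+) (- c) ` S" "v \<in> (+) (- c) ` S"
      using imageI[OF that(1), of "(+) (- c)"] imageI[OF that(2), of "(+) (- c)"] by simp_all
    ultimately have "a *\<^sub>R u + b *\<^sub>R v \<in> (+) (- c) ` S"
      by (intro subspace_add subspace_scale)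
    then show ?thesis by auto
  qed
  \<comment> \<open>Sums and multiples of projected vectors satisfy the orthogonality
    characterization \<open>QI\<close>, so uniqueness gives linearity.\<close>
  have linQ: "linear Q"
  proof (rule linearI)
    show "Q (u + v) = Q u + Q v" for u v
      using comb[OF QS QS, of 1 u 1 v] orth[of _ u] orth[of _ v]
      by (intro QI) (auto simp: inner_diff_left inner_add_left)
    show "Q (r *\<^sub>R u) = r *\<^sub>R Q u" for r u
      using comb[OF QS QS, of r u 0 u] orth[of _ u]
      by (intro QI) (auto simp: inner_diff_left)
  qed
  show "linear (\<lambda>y. 2 *\<^sub>R Q y - y)"
    by (intro linear_compose_sub linear_compose_scale_right linQ linear_ident)
  \<comment> \<open>The squared norms differ by \<open>4 * (Q y \<bullet> (Q y - y))\<close>, which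
    is 0 by orthogonality.\<close>
  show "norm (2 *\<^sub>R Q y - y) = norm y" for y
    using orth[OF QS, of y y]
    by (simp add: norm_eq inner_diff inner_commute)
  show "refl_about S x = c + (2 *\<^sub>R Q (x - c) - (x - c))" for x
    by (simp add: refl_about_def Q_def algebra_simps scaleR_2)
qed

text \<open>The reflection \<open>2L - I\<close> is the composite \<open>R' R\<close> of two linear
  isometries, hence an isometry.\<close>

lemma DR_linear_part:
  assumes "closed A" "affine A" "c \<in> A" "closed B" "affine B" "c \<in> B"
  shows "\<exists>L. firm L \<and> (\<forall>x. DR A B x = c + L (x - c))"
proof -
  obtain R where R: "linear R" "\<And>y. norm (R y) = norm y" "\<And>x. refl_about A x = c + R (x - c)"
    using refl_about_linear_part[OF assms(1-3)] by metis
  obtain R' where R': "linear R'" "\<And>y. norm (R' y) = norm y"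
    "\<And>x. refl_about B x = c + R' (x - c)"
    using refl_about_linear_part[OF assms(4-6)] by metis
  define L where "L y = (1/2) *\<^sub>R (y + R' (R y))" for y
  have "linear (\<lambda>y. R' (R y))"
    using linear_compose[OF R(1) R'(1)] by (simp add: o_def)
  then have "linear L"
    unfolding L_def by (intro linear_compose_scale_right linear_compose_add linear_ident)
  then have "firm L"
    by (simp add: firm_def L_def R R')
  moreover have "DR A B x = c + L (x - c)" for x
  proof -
    have "c = (1/2) *\<^sub>R c + (1/2) *\<^sub>R c"
      by (simp flip: scaleR_left_distrib)
    then show ?thesis
      by (simp add: DR_def L_def R R' algebra_simps)
  qed
  ultimately show ?thesis by blast
qed

text \<open>Translation by \<open>c\<close> conjugates \<open>T\<close> to \<open>L\<close> and
  carries the fixed space of \<open>L\<close> onto \<open>Fix T\<close>, so the limit and its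
  orthogonality transfer.\<close>

lemma affine_iterates_tendsto_proj:
  fixes L :: "'a::{real_inner,complete_space} \<Rightarrow> 'a"
  assumes "firm L" "\<And>x. T x = c + L (x - c)"
  shows "(\<lambda>n. (T ^^ n) x) \<longlonglongrightarrow> proj (Fix T) x"
proof -
  obtain p where p: "(\<lambda>n. (L ^^ n) (x - c)) \<longlonglongrightarrow> p" "L p = p"
    and orth: "\<And>f. L f = f \<Longrightarrow> (x - c - p) \<bullet> f = 0"
    using firm_iterates_converge[OF assms(1)] by metis
  have iter: "(T ^^ n) x = c + (L ^^ n) (x - c)" for n
    by (induction n) (auto simp: assms(2))
  have fix_iff: "y \<in> Fix T \<longleftrightarrow> L (y - c) = y - c" for y
    by (auto simp: Fix_def assms(2) algebra_simps)
  have "proj (Fix T) x = c + p"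
  proof (rule proj_eqI)
    show "c + p \<in> Fix T" using p(2) by (simp add: fix_iff)
    fix y assume "y \<in> Fix T"
    then have "(x - c - p) \<bullet> (y - c) = 0"
      using orth fix_iff by blast
    then show "(x - (c + p)) \<bullet> (y - (c + p)) = 0"
      using orth[OF p(2)] by (simp add: diff_diff_eq[symmetric] inner_diff_right)
  qed
  then show ?thesis
    using tendsto_add[OF tendsto_const p(1), of c] by (simp add: iter)
qed

theorem theorem4p2:
  fixes C :: "nat \<Rightarrow> 'a::{real_inner,complete_space} set"
    and N :: nat
    and x0 :: 'a
  assumes "N \<ge> 1"
    and "\<And>i. i \<in> {1..N} \<Longrightarrow> closed (C i)"
    and "\<And>i. i \<in> {1..N} \<Longrightarrow> affine (C i)"
    and "(\<Inter>i\<in>{1..N}. C i) \<noteq> {}"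
    and "C (N + 1) = C 1"
  shows "(\<lambda>n. ((\<lambda>x. (1 / real N) *\<^sub>R (\<Sum>i=1..N. DR (C i) (C (i + 1)) x)) ^^ n) x0)
           \<longlonglongrightarrow> proj (Fix (cyclic_DR C N)) x0"
proof -
  obtain c where "c \<in> (\<Inter>i\<in>{1..N}. C i)"
    using assms(4) by blast
  then have c: "c \<in> C i" if "i \<in> {1..N}" for i
    using that by (rule INT_D)
  \<comment> \<open>Index \<open>N + 1\<close> is included so that the closing pair
    \<open>C N\<close>, \<open>C 1\<close> is handled like the others.\<close>
  have C: "closed (C i) \<and> affine (C i) \<and> c \<in> C i" if "i \<in> {1..N + 1}" for i
    using that assms c by (cases "i = N + 1") auto
  have "\<exists>L. firm L \<and> (\<forall>x. DR (C i) (C (i + 1)) x = c + L (x - c))" if "i \<in> {1..N}" for i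
    using that C[of i] C[of "i + 1"] by (intro DR_linear_part) auto
  then obtain L where L: "\<And>i. i \<in> {1..N} \<Longrightarrow> firm (L i)"
    and DR: "\<And>i x. i \<in> {1..N} \<Longrightarrow> DR (C i) (C (i + 1)) x = c + L i (x - c)"
    by metis
  define A where "A x = (1 / real N) *\<^sub>R (\<Sum>i=1..N. L i x)" for x
  define T where "T x = (1 / real N) *\<^sub>R (\<Sum>i=1..N. DR (C i) (C (i + 1)) x)" for x
  have "firm A"
    using firm_average[of "{1..N}" L] L assms(1) by (simp add: A_def[abs_def])
  have T: "T x = c + A (x - c)" for x
  proof -
    have "(\<Sum>i=1..N. DR (C i) (C (i + 1)) x) = (\<Sum>i=1..N. c + L i (x - c))"
      by (intro sum.cong refl DR)
    also have "\<dots> = real N *\<^sub>R c + (\<Sum>i=1..N. L i (x - c))"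
      by (simp only: sum.distrib sum_constant_scaleR card_atLeastAtMost) simp
    finally show ?thesis
      using assms(1) by (simp add: T_def A_def scaleR_right_distrib)
  qed
  \<comment> \<open>Since \<open>C (N + 1) = C 1\<close>, the separate outer factor of
    \<open>cyclic_DR\<close> becomes the last step of one uniform fold.\<close>
  have "cyclic_DR C N x = fold (\<lambda>i. DR (C i) (C (i + 1))) [1..<N + 1] x" for x
    using assms(1,5) by (simp add: cyclic_DR_def)
  then have "cyclic_DR C N x = x \<longleftrightarrow> (\<forall>i\<in>{1..N}. DR (C i) (C (i + 1)) x = x)" for x
    using fold_fixed_iff[of "[1..<N + 1]" L "\<lambda>i. DR (C i) (C (i + 1))" c x] L DR
    by (auto simp del: upt_Suc)
  moreover have "T x = x \<longleftrightarrow> (\<forall>i\<in>{1..N}. DR (C i) (C (i + 1)) x = x)" for x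
  proof -
    have "T x = x \<longleftrightarrow> A (x - c) = x - c"
      by (auto simp: T algebra_simps)
    also have "\<dots> \<longleftrightarrow> (\<forall>i\<in>{1..N}. L i (x - c) = x - c)"
      using firm_average_fixed_iff[of "{1..N}" L "x - c"] L assms(1) by (simp add: A_def)
    also have "\<dots> \<longleftrightarrow> (\<forall>i\<in>{1..N}. DR (C i) (C (i + 1)) x = x)"
      using DR by (intro ball_cong refl) (auto simp del: atLeastAtMost_iff simp: algebra_simps)
    finally show ?thesis .
  qed
  ultimately have "Fix (cyclic_DR C N) = Fix T"
    by (simp add: Fix_def)
  with affine_iterates_tendsto_proj[OF \<open>firm A\<close> T, of x0] show ?thesis
    by (simp add: T_def[abs_def])
qed

end
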